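(* Let $P_A$ be a probability on $(\Omega,\mathcal{F})$ which satisfies (PN). Then $P_A$ satisfies (PEI) if and only if $P_A$ satisfies (PNFI).
   Context: Setting. Let $M\ge1$ and $K=\{1,\dots,M\}$. Let $(\Omega_O,\mathcal{F}_O,\mathbb{P}_O)$ be a probability space carrying a random variable $X^O$ with values in $\{0,\dots,M\}$, and let $\mathcal{X}^O=\{k: 1\le k\le X^O\}$, a random subset of $K$. Put $q_n=\mathbb{P}_O(X^O=n)$ and $Q_n=\mathbb{P}_O(X^O\ge n)$ for $0\le n\le M$, and assume $q_M>0$. The space is assumed to have the following structure: (1) There exist independent random variables $V_0^O,\dots,V_M^O,U^O$ on $\Omega_O$ such that $U^O$ is uniform on $[0,1]$ and each $V^O_n$ is $\{0,1\}$-valued with $\mathbb{P}_O(V_n^O=1)=1-\mathbb{P}_O(V_n^O=0)=q_n/Q_n$, $0\le n\le M$. (2) $\mathcal{F}_O=\sigma(U^O,V_n^O,0\le n\le M)$. (3) $X^O=\min\{n: V_n^O=1\}$. (Since $q_M/Q_M=1$, the set is nonempty almost surely; on the null event where all $V_n^O=0$ set $X^O=M$.) Let $\partial$ be a point not in $K$, $\Omega_A=K\cup\{\partial\}$, $\Omega=\Omega_O\times\Omega_A$, and $S:\Omega\to\Omega_A$, $S((\omega,x))=x$. Let $\mathcal{F}_W=\{F\times\Omega_A: F\in\mathcal{F}_O\}$ and $\mathcal{F}=\sigma(\mathcal{F}_W,S)$. The probability $\mathbb{P}$ on $(\Omega,\mathcal{F}_W)$ is defined by $\mathbb{P}(F\times\Omega_A)=\mathbb{P}_O(F)$.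 Random variables $Y^O$ on $\Omega_O$ are extended to $\Omega$ by $Y((\omega,x))=Y^O(\omega)$; thus $X,\mathcal{X},V_n,U$ are the extensions of $X^O,\mathcal{X}^O,V_n^O,U^O$. Principles, for a probability $P_A$ on $(\Omega,\mathcal{F})$: (PN): (i) if $F\in\mathcal{F}_W$ and $\mathbb{P}(F)=0$ then $P_A(F)=0$; (ii) $P_A(S\in\mathcal{X})=1$. (PEI): if $F\in\mathcal{F}_W$, $x\in K$ and $P_A(S=x)>0$, then $P_A(F\mid S=x)=\mathbb{P}(F\mid x\in\mathcal{X})$. (PNFI): whenever $1\le n\le M$, $P_A(S=n)>0$, and $G\in\sigma(V_n,\dots,V_M,U)$, one has $P_A(G\mid S=n)=\mathbb{P}(G)$. *)

theory Defs
  imports "HOL-Probability.Probability"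
begin

text \<open>
  The independent variables \<open>U\<close>, \<open>V 0\<close>, ..., \<open>V M\<close> are packed into a single family indexed by
  \<^typ>\<open>nat option\<close>: \<^term>\<open>None\<close> stands for \<open>U\<close>, \<open>Some n\<close> for \<open>V n\<close>.
\<close>

definition noise :: "(nat \<Rightarrow> 'a \<Rightarrow> real) \<Rightarrow> ('a \<Rightarrow> real) \<Rightarrow> nat option \<Rightarrow> 'a \<Rightarrow> real" where
  "noise V U i = (case i of None \<Rightarrow> U | Some n \<Rightarrow> V n)"

definition noise_idx :: "nat \<Rightarrow> nat \<Rightarrow> nat option set" where
  "noise_idx n M = insert None (Some ` {n..M})"

definition generated_events :: "'a set \<Rightarrow> ('i \<Rightarrow> 'a \<Rightarrow> real) \<Rightarrow> 'i set \<Rightarrow> 'a set set" where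
  "generated_events \<Omega> Y I = sigma_sets \<Omega> (\<Union>i\<in>I. {Y i -` A \<inter> \<Omega> | A. A \<in> sets borel})"

definition pt_prob :: "'a measure \<Rightarrow> ('a \<Rightarrow> nat) \<Rightarrow> nat \<Rightarrow> real" where
  "pt_prob MO X n = \<P>(\<omega> in MO. X \<omega> = n)"

definition tail_prob :: "'a measure \<Rightarrow> ('a \<Rightarrow> nat) \<Rightarrow> nat \<Rightarrow> real" where
  "tail_prob MO X n = \<P>(\<omega> in MO. n \<le> X \<omega>)"

text \<open>
  \<open>MO\<close> is the objective probability space, \<open>K = {1..M}\<close>, and \<open>cem\<close> is the extra
  point (written \<open>\<partial>\<close> informally), an arbitrary number outside \<open>K\<close>.
\<close>

locale observer_setting = prob_space MO
  for MO :: "'a measure" and M :: nat and X :: "'a \<Rightarrow> nat"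
    and V :: "nat \<Rightarrow> 'a \<Rightarrow> real" and U :: "'a \<Rightarrow> real" and cem :: nat +
  assumes M_ge_1: "1 \<le> M"
    and X_rv: "X \<in> measurable MO (count_space {0..M})"
    and q_M_pos: "0 < pt_prob MO X M"
    and indep: "prob_space.indep_vars MO (\<lambda>_. borel) (noise V U) (noise_idx 0 M)"
    and U_uniform: "distr MO borel U = uniform_measure lborel {0..1}"
    and V_range: "\<And>n \<omega>. n \<le> M \<Longrightarrow> \<omega> \<in> space MO \<Longrightarrow> V n \<omega> \<in> {0, 1}"
    and V_prob: "\<And>n. n \<le> M \<Longrightarrow> \<P>(\<omega> in MO. V n \<omega> = 1) = pt_prob MO X n / tail_prob MO X n"
    and sets_MO: "sets MO = generated_events (space MO) (noise V U) (noise_idx 0 M)"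
    and X_eq: "\<And>\<omega>. \<omega> \<in> space MO \<Longrightarrow>
      X \<omega> = (if \<exists>n\<le>M. V n \<omega> = 1 then Min {n. n \<le> M \<and> V n \<omega> = 1} else M)"
    and cem: "cem \<notin> {1..M}"

definition agents :: "nat \<Rightarrow> nat \<Rightarrow> nat set" where
  "agents M cem = insert cem {1..M}"

definition ext_space :: "'a measure \<Rightarrow> nat \<Rightarrow> nat \<Rightarrow> ('a \<times> nat) set" where
  "ext_space MO M cem = space MO \<times> agents M cem"

definition world_events :: "'a measure \<Rightarrow> nat \<Rightarrow> nat \<Rightarrow> ('a \<times> nat) set set" where
  "world_events MO M cem = {F \<times> agents M cem | F. F \<in> sets MO}"

definition self :: "'a \<times> nat \<Rightarrow> nat" where
  "self w = snd w"

definition ext :: "('a \<Rightarrow> 'b) \<Rightarrow> 'a \<times> nat \<Rightarrow> 'b" where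
  "ext Y w = Y (fst w)"

definition all_events :: "'a measure \<Rightarrow> nat \<Rightarrow> nat \<Rightarrow> ('a \<times> nat) set set" where
  "all_events MO M cem = sigma_sets (ext_space MO M cem)
     (world_events MO M cem \<union> {self -` A \<inter> ext_space MO M cem | A. A \<subseteq> agents M cem})"

text \<open>
  The objective probability on the extended space. For \<open>G = F \<times> agents M cem\<close> one has
  \<open>fst ` G = F\<close>; see \<open>emeasure_world\<close> below.
\<close>

definition world :: "'a measure \<Rightarrow> nat \<Rightarrow> nat \<Rightarrow> ('a \<times> nat) measure" where
  "world MO M cem = measure_of (ext_space MO M cem) (world_events MO M cem)
     (\<lambda>G. emeasure MO (fst ` G))"

definition persons :: "('a \<Rightarrow> nat) \<Rightarrow> 'a \<Rightarrow> nat set" where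
  "persons X \<omega> = {k. 1 \<le> k \<and> k \<le> X \<omega>}"

definition PN :: "'a measure \<Rightarrow> nat \<Rightarrow> ('a \<Rightarrow> nat) \<Rightarrow> nat \<Rightarrow> ('a \<times> nat) measure \<Rightarrow> bool" where
  "PN MO M X cem PA \<longleftrightarrow>
     (\<forall>F\<in>world_events MO M cem. measure (world MO M cem) F = 0 \<longrightarrow> measure PA F = 0) \<and>
     \<P>(w in PA. self w \<in> ext (persons X) w) = 1"

definition PEI :: "'a measure \<Rightarrow> nat \<Rightarrow> ('a \<Rightarrow> nat) \<Rightarrow> nat \<Rightarrow> ('a \<times> nat) measure \<Rightarrow> bool" where
  "PEI MO M X cem PA \<longleftrightarrow>
     (\<forall>F\<in>world_events MO M cem. \<forall>x\<in>{1..M}. \<P>(w in PA. self w = x) > 0 \<longrightarrow>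
        \<P>(w in PA. w \<in> F \<bar> self w = x)
          = \<P>(w in world MO M cem. w \<in> F \<bar> x \<in> ext (persons X) w))"

definition PNFI :: "'a measure \<Rightarrow> nat \<Rightarrow> (nat \<Rightarrow> 'a \<Rightarrow> real) \<Rightarrow> ('a \<Rightarrow> real) \<Rightarrow> nat
    \<Rightarrow> ('a \<times> nat) measure \<Rightarrow> bool" where
  "PNFI MO M V U cem PA \<longleftrightarrow>
     (\<forall>n\<in>{1..M}. \<P>(w in PA. self w = n) > 0 \<longrightarrow>
        (\<forall>G\<in>generated_events (ext_space MO M cem) (\<lambda>i. ext (noise V U i)) (noise_idx n M).
           \<P>(w in PA. w \<in> G \<bar> self w = n) = measure (world MO M cem) G))"

lemma fst_world_event: "fst ` (F \<times> agents M cem) = F"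
  by (auto simp: agents_def image_iff)

lemma space_world: "space (world MO M cem) = ext_space MO M cem"
  unfolding world_def
  by (rule space_measure_of) (auto simp: world_events_def ext_space_def dest: sets.sets_into_space)

lemma sigma_algebra_world: "sigma_algebra (ext_space MO M cem) (world_events MO M cem)"
proof -
  let ?A = "agents M cem"
  have "world_events MO M cem = {fst -` F \<inter> ext_space MO M cem | F. F \<in> sets MO}"
  proof -
    have "F \<times> ?A = fst -` F \<inter> ext_space MO M cem" if "F \<in> sets MO" for F
      using sets.sets_into_space[OF that] by (auto simp: ext_space_def)
    then show ?thesis unfolding world_events_def by blast
  qed
  moreover have "sigma_algebra (ext_space MO M cem)
      {fst -` F \<inter> ext_space MO M cem | F. F \<in> sets MO}"
  proof -
    have "fst \<in> ext_space MO M cem \<rightarrow> space MO" by (auto simp: ext_space_def)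
    from sets_vimage_algebra2[OF this]
    show ?thesis
      by (metis sets.sigma_algebra_axioms space_vimage_algebra)
  qed
  ultimately show ?thesis by simp
qed

lemma sets_world: "sets (world MO M cem) = world_events MO M cem"
  unfolding world_def
  by (rule sigma_algebra.sets_measure_of_eq[OF sigma_algebra_world])

lemma emeasure_world:
  assumes "F \<in> sets MO"
  shows "emeasure (world MO M cem) (F \<times> agents M cem) = emeasure MO F"
proof -
  have "countably_additive (world_events MO M cem) (\<lambda>G. emeasure MO (fst ` G))"
  proof (rule countably_additiveI)
    fix G :: "nat \<Rightarrow> ('a \<times> nat) set"
    assume r: "range G \<subseteq> world_events MO M cem" and d: "disjoint_family G"
    then have "\<forall>i. \<exists>F. F \<in> sets MO \<and> G i = F \<times> agents M cem"
      by (auto simp: world_events_def)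
    then obtain H where H: "\<And>i. H i \<in> sets MO" "\<And>i. G i = H i \<times> agents M cem"
      by metis
    have "cem \<in> agents M cem" by (simp add: agents_def)
    then have "disjoint_family H"
      using d unfolding disjoint_family_on_def H(2) by blast
    then have "(\<Sum>i. emeasure MO (H i)) = emeasure MO (\<Union>i. H i)"
      using H(1) by (intro suminf_emeasure) auto
    then show "(\<Sum>i. emeasure MO (fst ` G i)) = emeasure MO (fst ` (\<Union>i. G i))"
      by (simp add: H(2) fst_world_event image_UN)
  qed
  then have "emeasure (world MO M cem) (F \<times> agents M cem)
      = emeasure MO (fst ` (F \<times> agents M cem))"
    unfolding world_def using assms
    by (intro emeasure_measure_of_sigma[OF sigma_algebra_world])
       (auto simp: positive_def world_events_def)
  then show ?thesis unfolding fst_world_event .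
qed

end

theory Submission
  imports Defs
begin

text \<open>
  Fix \<open>n\<close> in \<open>{1..M}\<close> and let \<open>B\<close> be the event \<open>n \<le> X\<close>. Because \<open>X\<close> is the first index at which
  \<open>V\<close> takes the value 1, \<open>B\<close> says exactly that \<open>V 0, ..., V (n - 1)\<close> all vanish. Two things follow.

  \<^item> \<open>B\<close> belongs to the sigma-algebra of the early variables \<open>V 0, ..., V (n - 1)\<close>, hence is
    independent of the sigma-algebra of the late variables \<open>V n, ..., V M, U\<close>: for late events,
    conditioning on \<open>B\<close> changes nothing (\<open>cond_prob_late\<close>).
  \<^item> On \<open>B\<close> the early variables are constant, so every event \<open>F\<close> of the space agrees on \<open>B\<close> with some
    late event \<open>G\<close> (\<open>late_representative\<close>).

  The objective conditional law given \<open>n \<in> persons X\<close>, which is the law given \<open>B\<close>, therefore extends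
  the unconditional law of the late variables, and (PEI) gives (PNFI). Conversely, (PN) says that an
  agent exists, so \<open>B\<close> holds almost surely given that the agent is \<open>n\<close>. Under both conditional laws,
  the subjective one given \<open>self = n\<close> and the objective one given \<open>B\<close>, the event \<open>F\<close> can thus be
  replaced by \<open>G\<close>. On late events (PNFI) makes the two laws agree, so they agree on \<open>F\<close>, which is
  (PEI).
\<close>

section \<open>Generated sigma-algebras\<close>

text \<open>
  Restricted to a set on which some of the variables are constant, a generated sigma-algebra loses
  the contribution of those variables. The events with the required \<open>G\<close> form a sigma-algebra, so
  only the generators need to be inspected.
\<close>

lemma generated_events_trace:
  assumes F: "F \<in> generated_events \<Omega> Y (I \<union> J)"
    and const: "\<And>j \<omega>. j \<in> J \<Longrightarrow> \<omega> \<in> B \<Longrightarrow> Y j \<omega> = c j"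
    and B: "B \<subseteq> \<Omega>"
  shows "\<exists>G\<in>generated_events \<Omega> Y I. F \<inter> B = G \<inter> B"
  using F unfolding generated_events_def
proof (induction rule: sigma_sets.induct)
  case (Basic a)
  then obtain i A where i: "i \<in> I \<union> J" and A: "A \<in> sets borel" and a: "a = Y i -` A \<inter> \<Omega>"
    by auto
  show ?case
  proof (cases "i \<in> I")
    case True
    then show ?thesis using A a by blast
  next
    case False
    with i have "a \<inter> B = (if c i \<in> A then \<Omega> else {}) \<inter> B"
      using const[of i] B by (auto simp: a)
    then show ?thesis
      by (rule bexI) (simp add: sigma_sets.Empty sigma_sets_top)
  qed
next
  case Empty
  then show ?case by (intro bexI[of _ "{}"] sigma_sets.Empty) simp
next
  case (Compl a)
  then obtain G where G: "G \<in> sigma_sets \<Omega> (\<Union>i\<in>I. {Y i -` A \<inter> \<Omega> |A. A \<in> sets borel})"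
    and eq: "a \<inter> B = G \<inter> B" by blast
  have "(\<Omega> - a) \<inter> B = (\<Omega> - G) \<inter> B" using eq by blast
  then show ?case using sigma_sets.Compl[OF G] by (rule bexI)
next
  case (Union a)
  then have "\<forall>k. \<exists>G. G \<in> sigma_sets \<Omega> (\<Union>i\<in>I. {Y i -` A \<inter> \<Omega> |A. A \<in> sets borel})
      \<and> a k \<inter> B = G \<inter> B" by blast
  from choice[OF this] obtain G where
    G: "\<And>k. G k \<in> sigma_sets \<Omega> (\<Union>i\<in>I. {Y i -` A \<inter> \<Omega> |A. A \<in> sets borel})"
    and eq: "\<And>k. a k \<inter> B = G k \<inter> B" by blast
  have "(\<Union>k. a k) \<inter> B = (\<Union>k. G k) \<inter> B" using eq by blast
  then show ?case using sigma_sets.Union[OF G] by (rule bexI)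
qed

lemma generated_events_mono:
  assumes "I \<subseteq> J"
  shows "generated_events \<Omega> Y I \<subseteq> generated_events \<Omega> Y J"
  unfolding generated_events_def using assms by (intro sigma_sets_mono') blast

lemma generated_events_ext:
  "generated_events (ext_space MO M cem) (\<lambda>i. ext (Y i)) I
     = (\<lambda>H. H \<times> agents M cem) ` generated_events (space MO) Y I"
proof -
  let ?E = "\<Union>i\<in>I. {Y i -` A \<inter> space MO |A. A \<in> sets borel}"
  let ?\<Omega> = "ext_space MO M cem"
  have gens: "(\<Union>i\<in>I. {ext (Y i) -` A \<inter> ?\<Omega> |A. A \<in> sets borel})
      = {fst -` H \<inter> ?\<Omega> |H. H \<in> ?E}"
  proof -
    have "ext (Y i) -` A \<inter> ?\<Omega> = fst -` (Y i -` A \<inter> space MO) \<inter> ?\<Omega>" for i A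
      by (auto simp: ext_def ext_space_def)
    then show ?thesis
      by (simp only: setcompr_eq_image image_UN image_image Collect_mem_eq)
  qed
  have "fst \<in> ?\<Omega> \<rightarrow> space MO" by (auto simp: ext_space_def)
  from sigma_sets_vimage_commute[OF this, of ?E]
  have "generated_events ?\<Omega> (\<lambda>i. ext (Y i)) I
      = (\<lambda>H. fst -` H \<inter> ?\<Omega>) ` generated_events (space MO) Y I"
    unfolding generated_events_def gens by (simp only: setcompr_eq_image Collect_mem_eq)
  moreover have "fst -` H \<inter> ?\<Omega> = H \<times> agents M cem"
    if "H \<in> generated_events (space MO) Y I" for H
  proof -
    have "H \<subseteq> space MO"
      using that unfolding generated_events_def by (rule sigma_sets_into_sp[rotated]) blast
    then show ?thesis by (auto simp: ext_space_def)
  qed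
  ultimately show ?thesis by (simp cong: image_cong)
qed

section \<open>Early and late variables\<close>

context observer_setting
begin

lemma noise_idx_split: "n \<le> M \<Longrightarrow> noise_idx 0 M = noise_idx n M \<union> Some ` {..<n}"
  by (auto simp: noise_idx_def image_iff)

lemma late_events_sets:
  assumes "n \<le> M"
  shows "generated_events (space MO) (noise V U) (noise_idx n M) \<subseteq> sets MO"
  using generated_events_mono[of "noise_idx n M" "noise_idx 0 M" "space MO" "noise V U"]
  by (simp add: sets_MO noise_idx_split[OF assms])

text \<open>
  The equivalence holds at every sample point and not just almost surely: if no \<open>V k\<close> equals 1, the
  convention \<open>X = M\<close> makes both sides true.
\<close>

lemma le_X_iff:
  assumes n: "n \<le> M" and \<omega>: "\<omega> \<in> space MO"
  shows "n \<le> X \<omega> \<longleftrightarrow> (\<forall>k<n. V k \<omega> = 0)"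
proof -
  let ?S = "{m. m \<le> M \<and> V m \<omega> = 1}"
  have zero: "V k \<omega> = 0 \<longleftrightarrow> V k \<omega> \<noteq> 1" if "k < n" for k
    using V_range[of k \<omega>] that n \<omega> by auto
  show ?thesis
  proof (cases "?S = {}")
    case True
    then show ?thesis using X_eq[OF \<omega>] n zero by auto
  next
    case False
    then have "X \<omega> = Min ?S" using X_eq[OF \<omega>] by auto
    moreover have "finite ?S" by simp
    ultimately have "n \<le> X \<omega> \<longleftrightarrow> (\<forall>m\<in>?S. n \<le> m)"
      using False by (simp add: Min_ge_iff)
    also have "\<dots> \<longleftrightarrow> (\<forall>k<n. V k \<omega> \<noteq> 1)"
      using n by (metis (mono_tags, lifting) less_le_trans linorder_not_less mem_Collect_eq nless_le)
    finally show ?thesis using zero by auto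
  qed
qed

lemma le_X_early:
  assumes "n \<le> M"
  shows "{\<omega>\<in>space MO. n \<le> X \<omega>} \<in> generated_events (space MO) (noise V U) (Some ` {..<n})"
    (is "_ \<in> ?E")
proof -
  interpret E: sigma_algebra "space MO" ?E
    unfolding generated_events_def by (intro sigma_algebra_sigma_sets) blast
  have "V k -` {0} \<inter> space MO \<in> ?E" if "k < n" for k
    unfolding generated_events_def using that
    by (intro sigma_sets.Basic UN_I[of "Some k"])
       (auto simp: noise_def intro!: exI[of _ "{0}"])
  then have "(\<forall>k\<in>{..<n}. {\<omega>\<in>space MO. V k \<omega> = 0} \<in> ?E)"
    by (auto simp: vimage_def Int_def conj_commute)
  then have "{\<omega>\<in>space MO. \<forall>k\<in>{..<n}. V k \<omega> = 0} \<in> ?E"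
    by (intro E.sets_Collect_finite_All) auto
  moreover have "{\<omega>\<in>space MO. n \<le> X \<omega>} = {\<omega>\<in>space MO. \<forall>k\<in>{..<n}. V k \<omega> = 0}"
    using le_X_iff[OF assms] by auto
  ultimately show ?thesis by simp
qed

lemma le_X_measurable: "{\<omega>\<in>space MO. n \<le> X \<omega>} \<in> events"
proof -
  have "{\<omega>\<in>space MO. n \<le> X \<omega>} = X -` {n..M} \<inter> space MO"
    using measurable_space[OF X_rv] by auto
  then show ?thesis using measurable_sets[OF X_rv, of "{n..M}"] by auto
qed

lemma prob_le_X_pos:
  assumes "n \<le> M"
  shows "0 < \<P>(\<omega> in MO. n \<le> X \<omega>)"
proof -
  have "\<P>(\<omega> in MO. X \<omega> = M) \<le> \<P>(\<omega> in MO. n \<le> X \<omega>)"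
    using assms by (intro finite_measure_mono le_X_measurable) auto
  then show ?thesis using q_M_pos by (simp add: pt_prob_def)
qed

text \<open>
  Disjoint blocks of an independent family generate independent sigma-algebras, and \<open>n \<le> X\<close> lies in
  the early block.
\<close>

lemma cond_prob_late:
  assumes n: "n \<le> M"
    and G: "G \<in> generated_events (space MO) (noise V U) (noise_idx n M)"
  shows "\<P>(\<omega> in MO. \<omega> \<in> G \<bar> n \<le> X \<omega>) = prob G"
proof -
  let ?B = "{\<omega>\<in>space MO. n \<le> X \<omega>}"
  let ?E = "\<lambda>i. {noise V U i -` A \<inter> space MO |A. A \<in> sets borel}"
  let ?I = "case_bool (noise_idx n M) (Some ` {..<n})"
  have "indep_sets ?E (\<Union>b\<in>UNIV. ?I b)"
    using indep noise_idx_split[OF n] unfolding indep_vars_def2 by (simp add: UNIV_bool Un_commute)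
  moreover have "Int_stable (?E i)" for i
  proof (rule Int_stableI, clarify)
    fix A A' :: "real set" assume "A \<in> sets borel" "A' \<in> sets borel"
    then show "\<exists>C. (noise V U i -` A \<inter> space MO) \<inter> (noise V U i -` A' \<inter> space MO)
        = noise V U i -` C \<inter> space MO \<and> C \<in> sets borel"
      by (intro exI[of _ "A \<inter> A'"]) auto
  qed
  moreover have "disjoint_family_on ?I UNIV"
    by (auto simp: disjoint_family_on_def noise_idx_def split: bool.splits)
  ultimately have
    "indep_sets (\<lambda>b. generated_events (space MO) (noise V U) (?I b)) UNIV"
    unfolding generated_events_def by (intro indep_sets_collect_sigma)
  then have "indep_set (generated_events (space MO) (noise V U) (noise_idx n M))
      (generated_events (space MO) (noise V U) (Some ` {..<n}))"
    unfolding indep_set_def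
    by (rule indep_sets_cong[THEN iffD1, rotated -1]) (auto split: bool.splits)
  then have "prob (G \<inter> ?B) = prob G * prob ?B"
    using G le_X_early[OF n] by (rule indep_setD)
  moreover have "{\<omega>\<in>space MO. \<omega> \<in> G \<and> n \<le> X \<omega>} = G \<inter> ?B" by auto
  ultimately show ?thesis
    using prob_le_X_pos[OF n] by (simp add: cond_prob_def)
qed

lemma late_representative:
  assumes n: "n \<le> M" and F: "F \<in> events"
  obtains G where "G \<in> generated_events (space MO) (noise V U) (noise_idx n M)"
    and "\<And>\<omega>. \<omega> \<in> space MO \<Longrightarrow> n \<le> X \<omega> \<Longrightarrow> \<omega> \<in> F \<longleftrightarrow> \<omega> \<in> G"
proof -
  let ?B = "{\<omega>\<in>space MO. n \<le> X \<omega>}"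
  have "noise V U j \<omega> = 0" if "j \<in> Some ` {..<n}" "\<omega> \<in> ?B" for j \<omega>
    using that le_X_iff[OF n] by (auto simp: noise_def)
  moreover have "F \<in> generated_events (space MO) (noise V U) (noise_idx n M \<union> Some ` {..<n})"
    using F by (simp add: sets_MO noise_idx_split[OF n])
  ultimately obtain G where "G \<in> generated_events (space MO) (noise V U) (noise_idx n M)"
    and "F \<inter> ?B = G \<inter> ?B"
    using generated_events_trace[of F "space MO" "noise V U" "noise_idx n M" "Some ` {..<n}"
        ?B "\<lambda>_. 0"] by blast
  then show ?thesis using that by blast
qed

section \<open>The extended space\<close>

lemma measure_world:
  assumes "F \<in> events"
  shows "measure (world MO M cem) (F \<times> agents M cem) = prob F"
  using emeasure_world[OF assms] by (simp add: measure_def)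

lemma cond_prob_world:
  assumes F: "F \<in> events" and n: "1 \<le> n"
  shows "\<P>(w in world MO M cem. w \<in> F \<times> agents M cem \<bar> n \<in> ext (persons X) w)
    = \<P>(\<omega> in MO. \<omega> \<in> F \<bar> n \<le> X \<omega>)"
proof -
  let ?B = "{\<omega>\<in>space MO. n \<le> X \<omega>}"
  have "{w\<in>space (world MO M cem). w \<in> F \<times> agents M cem \<and> n \<in> ext (persons X) w}
      = (F \<inter> ?B) \<times> agents M cem"
    using n by (auto simp: space_world ext_space_def ext_def persons_def)
  moreover have "{w\<in>space (world MO M cem). n \<in> ext (persons X) w} = ?B \<times> agents M cem"
    using n by (auto simp: space_world ext_space_def ext_def persons_def)
  moreover have "{\<omega>\<in>space MO. \<omega> \<in> F \<and> n \<le> X \<omega>} = F \<inter> ?B" by auto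
  ultimately show ?thesis
    using F le_X_measurable[of n] by (simp add: cond_prob_def measure_world sets.Int)
qed

text \<open>
  Expressed on the original space, both principles equate the same two conditional laws, the subjective
  one given \<open>self = n\<close> and the objective one given \<open>n \<le> X\<close>. (PEI) asks for this on all events, (PNFI)
  only on late ones, where the objective law is the unconditional one.
\<close>

lemma PEI_iff:
  "PEI MO M X cem PA \<longleftrightarrow>
    (\<forall>n\<in>{1..M}. \<P>(w in PA. self w = n) > 0 \<longrightarrow>
      (\<forall>F\<in>events. \<P>(w in PA. w \<in> F \<times> agents M cem \<bar> self w = n)
        = \<P>(\<omega> in MO. \<omega> \<in> F \<bar> n \<le> X \<omega>)))"
proof -
  have "\<P>(w in world MO M cem. w \<in> F \<times> agents M cem \<bar> n \<in> ext (persons X) w)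
      = \<P>(\<omega> in MO. \<omega> \<in> F \<bar> n \<le> X \<omega>)" if "n \<in> {1..M}" "F \<in> events" for n F
    using that by (intro cond_prob_world) auto
  then show ?thesis
    unfolding PEI_def world_events_def setcompr_eq_image Set.ball_simps(9) Collect_mem_eq
    by (simp cong: ball_cong_simp) blast
qed

lemma PNFI_iff:
  "PNFI MO M V U cem PA \<longleftrightarrow>
    (\<forall>n\<in>{1..M}. \<P>(w in PA. self w = n) > 0 \<longrightarrow>
      (\<forall>G\<in>generated_events (space MO) (noise V U) (noise_idx n M).
        \<P>(w in PA. w \<in> G \<times> agents M cem \<bar> self w = n) = \<P>(\<omega> in MO. \<omega> \<in> G \<bar> n \<le> X \<omega>)))"
proof -
  have "measure (world MO M cem) (G \<times> agents M cem) = \<P>(\<omega> in MO. \<omega> \<in> G \<bar> n \<le> X \<omega>)"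
    if "n \<in> {1..M}" "G \<in> generated_events (space MO) (noise V U) (noise_idx n M)" for n G
    using that late_events_sets[of n] by (subst measure_world) (auto simp: cond_prob_late)
  then show ?thesis
    unfolding PNFI_def generated_events_ext Set.ball_simps(9) by (simp cong: ball_cong_simp)
qed

text \<open>
  By (PN) a subjective observer who is agent \<open>n\<close> lives in a world with \<open>n \<le> X\<close>, so only the part of a
  world event inside \<open>n \<le> X\<close> matters to it.
\<close>

lemma subjective_cond_prob_cong:
  assumes PA: "prob_space PA"
    and space: "space PA = ext_space MO M cem"
    and sets: "sets PA = all_events MO M cem"
    and PN: "PN MO M X cem PA"
    and F: "F \<in> events" and G: "G \<in> events"
    and eq: "\<And>\<omega>. \<omega> \<in> space MO \<Longrightarrow> n \<le> X \<omega> \<Longrightarrow> \<omega> \<in> F \<longleftrightarrow> \<omega> \<in> G"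
    and n: "n \<in> {1..M}"
  shows "\<P>(w in PA. w \<in> F \<times> agents M cem \<bar> self w = n)
    = \<P>(w in PA. w \<in> G \<times> agents M cem \<bar> self w = n)"
proof -
  interpret PA: prob_space PA by (rule PA)
  have event: "H \<times> agents M cem \<in> sets PA" if "H \<in> events" for H
    unfolding sets all_events_def world_events_def using that
    by (intro sigma_sets.Basic) blast
  have "self -` {n} \<inter> ext_space MO M cem \<in> sets PA"
    unfolding sets all_events_def using n
    by (intro sigma_sets.Basic UnI2 CollectI exI[of _ "{n}"]) (auto simp: agents_def)
  then have self: "{w\<in>space PA. self w = n} \<in> sets PA"
    by (simp add: space vimage_def Int_def conj_commute)
  have meas: "{w\<in>space PA. w \<in> H \<times> agents M cem \<and> self w = n} \<in> sets PA" if "H \<in> events" for H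
  proof -
    have "{w\<in>space PA. w \<in> H \<times> agents M cem \<and> self w = n}
        = (H \<times> agents M cem) \<inter> {w\<in>space PA. self w = n}" by auto
    then show ?thesis using event[OF that] self by (metis sets.Int)
  qed
  have "AE w in PA. self w \<in> ext (persons X) w"
    using PA.AE_prob_1[of "{w\<in>space PA. self w \<in> ext (persons X) w}"] PN
    unfolding PN_def by auto
  then have "AE w in PA. w \<in> F \<times> agents M cem \<and> self w = n
      \<longleftrightarrow> w \<in> G \<times> agents M cem \<and> self w = n"
  proof (rule AE_mp, intro AE_I2 impI)
    fix w assume "w \<in> space PA" "self w \<in> ext (persons X) w"
    then show "w \<in> F \<times> agents M cem \<and> self w = n \<longleftrightarrow> w \<in> G \<times> agents M cem \<and> self w = n"
      using eq by (auto simp: space ext_space_def ext_def persons_def mem_Times_iff)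
  qed
  then have "\<P>(w in PA. w \<in> F \<times> agents M cem \<and> self w = n)
      = \<P>(w in PA. w \<in> G \<times> agents M cem \<and> self w = n)"
    using meas F G by (intro PA.finite_measure_eq_AE) auto
  then show ?thesis by (simp add: cond_prob_def)
qed

end

section \<open>Equivalence of the two principles\<close>

theorem theorem2p15:
  fixes MO :: "'a measure" and M :: nat and X :: "'a \<Rightarrow> nat"
    and V :: "nat \<Rightarrow> 'a \<Rightarrow> real" and U :: "'a \<Rightarrow> real" and cem :: nat
    and PA :: "('a \<times> nat) measure"
  assumes "observer_setting MO M X V U cem"
    and "prob_space PA"
    and "space PA = ext_space MO M cem"
    and "sets PA = all_events MO M cem"
    and "PN MO M X cem PA"
  shows "PEI MO M X cem PA \<longleftrightarrow> PNFI MO M V U cem PA"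
proof -
  interpret observer_setting MO M X V U cem by (rule assms(1))
  show ?thesis
  proof
    assume "PEI MO M X cem PA"
    then show "PNFI MO M V U cem PA"
      unfolding PEI_iff PNFI_iff using late_events_sets by (meson atLeastAtMost_iff subsetD)
  next
    assume PNFI: "PNFI MO M V U cem PA"
    show "PEI MO M X cem PA"
      unfolding PEI_iff
    proof (intro ballI impI)
      fix n F
      assume n: "n \<in> {1..M}" and pos: "\<P>(w in PA. self w = n) > 0" and F: "F \<in> events"
      from n have nM: "n \<le> M" by simp
      obtain G where G: "G \<in> generated_events (space MO) (noise V U) (noise_idx n M)"
        and eq: "\<And>\<omega>. \<omega> \<in> space MO \<Longrightarrow> n \<le> X \<omega> \<Longrightarrow> \<omega> \<in> F \<longleftrightarrow> \<omega> \<in> G"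
        using late_representative[OF nM F] by blast
      have "G \<in> events" using G late_events_sets[OF nM] by blast
      then have "\<P>(w in PA. w \<in> F \<times> agents M cem \<bar> self w = n)
          = \<P>(w in PA. w \<in> G \<times> agents M cem \<bar> self w = n)"
        using subjective_cond_prob_cong[OF assms(2-5) F _ eq n] by simp
      also have "\<dots> = \<P>(\<omega> in MO. \<omega> \<in> G \<bar> n \<le> X \<omega>)"
        using PNFI n pos G unfolding PNFI_iff by blast
      also have "\<dots> = \<P>(\<omega> in MO. \<omega> \<in> F \<bar> n \<le> X \<omega>)"
        unfolding cond_prob_def using eq by (metis (mono_tags, lifting))
      finally show "\<P>(w in PA. w \<in> F \<times> agents M cem \<bar> self w = n)
          = \<P>(\<omega> in MO. \<omega> \<in> F \<bar> n \<le> X \<omega>)" .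
    qed
  qed
qed

end
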